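(* Let $A$ be an alphabet and $\eta:A^*\to A^*$ a substitution with growing letter $a\in A$. Let $u=u_0u_1u_2\cdots\in A^{\mathbb{Z}_{\ge0}}$ be a right-infinite periodic point of $\eta$ with $u_0=a$, and let $p\geq1$ be a period of $u$. For every integer $n\geq1$ there exist a unique integer $k=k(n)$ such that $p$ divides $k$ and a unique sequence $(m_i,a_i)_{i=0,\dots,k-1}$ such that (i) this sequence is $a$-admissible and $m_{k-1}m_{k-2}\cdots m_{k-p}\neq\varepsilon$; (ii) $u_0u_1\cdots u_{n-1}=\eta^{k-1}(m_{k-1})\eta^{k-2}(m_{k-2})\cdots\eta^0(m_0)$.
   Context: An alphabet $A$ is a finite set; $A^*$ is the set of finite words, $\varepsilon$ the empty word, $|w|$ the length. A substitution is a morphism $\eta:A^*\to A^*$ such that $\eta(a)$ is nonempty for every $a\in A$ and some letter is growing; a letter $a$ is growing if $|\eta^k(a)|\to\infty$ as $k\to\infty$. $\eta$ acts on right-infinite words by $\eta(u_0u_1u_2\cdots)=\eta(u_0)\eta(u_1)\eta(u_2)\cdots$; $u$ is a periodic point if $\eta^p(u)=u$ for some $p\ge1$, and any such $p$ is called a period of $u$. A sequence $(m_i,a_i)_{i=0,\dots,k}$ in $A^*\times A$ is $x$-admissible if $m_{i-1}a_{i-1}$ is a prefix of $\eta(a_i)$ for all $1\le i\le k$ and $m_ka_k$ is a prefix of $\eta(x)$. *)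

theory Defs
  imports Complex_Main "HOL-Library.Stream" "HOL-Library.Sublist"
begin

definition word_morphism :: "('a list \<Rightarrow> 'a list) \<Rightarrow> bool" where
  "word_morphism \<eta> \<longleftrightarrow> \<eta> [] = [] \<and> (\<forall>v w. \<eta> (v @ w) = \<eta> v @ \<eta> w)"

definition growing :: "('a list \<Rightarrow> 'a list) \<Rightarrow> 'a \<Rightarrow> bool" where
  "growing \<eta> a \<longleftrightarrow> filterlim (\<lambda>k. length ((\<eta> ^^ k) [a])) at_top sequentially"

definition substitution :: "('a list \<Rightarrow> 'a list) \<Rightarrow> bool" where
  "substitution \<eta> \<longleftrightarrow>
     word_morphism \<eta> \<and> (\<forall>a. \<eta> [a] \<noteq> []) \<and> (\<exists>a. growing \<eta> a)"

text \<open>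
  The action on right-infinite words. Note that \<^const>\<open>flat\<close> is concatenation only for
  streams of nonempty words, which is the case here whenever \<open>\<eta>\<close> is a substitution.
\<close>
definition stream_action :: "('a list \<Rightarrow> 'a list) \<Rightarrow> 'a stream \<Rightarrow> 'a stream" where
  "stream_action \<eta> u = flat (smap (\<lambda>x. \<eta> [x]) u)"

definition is_period :: "('a list \<Rightarrow> 'a list) \<Rightarrow> 'a stream \<Rightarrow> nat \<Rightarrow> bool" where
  "is_period \<eta> u p \<longleftrightarrow> p \<ge> 1 \<and> (stream_action \<eta> ^^ p) u = u"

definition periodic_point :: "('a list \<Rightarrow> 'a list) \<Rightarrow> 'a stream \<Rightarrow> bool" where
  "periodic_point \<eta> u \<longleftrightarrow> (\<exists>p. is_period \<eta> u p)"

text \<open>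
  A sequence \<open>(m\<^sub>i, a\<^sub>i)\<close>, \<open>0 \<le> i \<le> k\<close>, is a list \<open>s\<close> of length \<open>k + 1\<close> (hence nonempty) with
  \<open>s ! i = (m\<^sub>i, a\<^sub>i)\<close>.
\<close>
definition admissible ::
    "('a list \<Rightarrow> 'a list) \<Rightarrow> 'a \<Rightarrow> ('a list \<times> 'a) list \<Rightarrow> bool" where
  "admissible \<eta> x s \<longleftrightarrow>
     s \<noteq> [] \<and>
     (\<forall>i. 1 \<le> i \<and> i < length s \<longrightarrow>
        prefix (fst (s ! (i - 1)) @ [snd (s ! (i - 1))]) (\<eta> [snd (s ! i)])) \<and>
     prefix (fst (last s) @ [snd (last s)]) (\<eta> [x])"

end

theory Submission
  imports Defs
begin

text \<open>
  Read from the top index down, an \<open>x\<close>-admissible sequence of length \<open>k\<close> is a path of successive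
  choices of a letter in \<open>\<eta>[x]\<close>, then in the image of that letter, and so on; it addresses one
  letter of \<open>\<eta>\<^sup>k[x]\<close>, and the word in (ii) is the part of \<open>\<eta>\<^sup>k[x]\<close> strictly before it. For each \<open>k\<close>
  these paths correspond bijectively to the lengths \<open>n < |\<eta>\<^sup>k[x]|\<close>: the first choice is the letter
  of \<open>\<eta>[x]\<close> whose block in \<open>\<eta>\<^bsup>k-1\<^esup>(\<eta>[x])\<close> contains position \<open>n\<close>, and the rest is recursion.
  Since \<open>\<eta>\<^sup>p[a]\<close> begins with \<open>a\<close>, the top \<open>p\<close> words \<open>m\<^sub>i\<close> are all empty exactly when the path
  stays in the initial factor \<open>\<eta>\<^bsup>k-p\<^esup>[a]\<close> of \<open>\<eta>\<^sup>k[a]\<close>. So the side condition in (i) says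
  \<open>|\<eta>\<^bsup>k-p\<^esup>[a]| \<le> n\<close>, and as \<open>|\<eta>\<^bsup>pq\<^esup>[a]|\<close> is unbounded and nondecreasing in \<open>q\<close>, exactly one
  multiple \<open>k\<close> of \<open>p\<close> satisfies \<open>|\<eta>\<^bsup>k-p\<^esup>[a]| \<le> n < |\<eta>\<^sup>k[a]|\<close>.
\<close>

lemma ex1_mono_interval:
  fixes f :: "nat \<Rightarrow> 'b::linorder"
  assumes "mono f" "f 0 \<le> y" "y < f N"
  shows "\<exists>!i. f i \<le> y \<and> y < f (Suc i)"
proof -
  obtain i where "f i \<le> y" "y < f (Suc i)"
    using ex_least_nat_less[of "\<lambda>i. y < f i" N] assms(2,3) by (auto simp: not_less)
  moreover have "j \<le> i" if "f j \<le> y" "y < f (Suc i)" for i j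
    using that monoD[OF assms(1), of "Suc i" j] by (meson leD le_less_trans not_less_eq_eq)
  ultimately show ?thesis by (blast intro: le_antisym)
qed

lemma map_nth_rev_upt:
  "map (\<lambda>i. f (s ! i)) (rev [length s - p..<length s]) = map f (take p (rev s))"
proof -
  have "map (\<lambda>i. f (s ! i)) [m..<length s] = map f (drop m s)" for m
    by (rule nth_equalityI) auto
  then show ?thesis by (simp add: take_rev flip: rev_map)
qed

text \<open>Paths list the pairs \<open>(m\<^sub>i, a\<^sub>i)\<close> with the highest index first.\<close>

fun admissible_path :: "('a list \<Rightarrow> 'a list) \<Rightarrow> 'a \<Rightarrow> ('a list \<times> 'a) list \<Rightarrow> bool" where
  "admissible_path \<eta> x [] \<longleftrightarrow> True"
| "admissible_path \<eta> x ((m, b) # t) \<longleftrightarrow> prefix (m @ [b]) (\<eta> [x]) \<and> admissible_path \<eta> b t"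

fun path_word :: "('a list \<Rightarrow> 'a list) \<Rightarrow> ('a list \<times> 'a) list \<Rightarrow> 'a list" where
  "path_word \<eta> [] = []"
| "path_word \<eta> ((m, b) # t) = (\<eta> ^^ length t) m @ path_word \<eta> t"

fun path_end :: "'a \<Rightarrow> ('a list \<times> 'a) list \<Rightarrow> 'a" where
  "path_end x [] = x"
| "path_end x ((m, b) # t) = path_end b t"

definition dumont_thomas_path ::
    "('a list \<Rightarrow> 'a list) \<Rightarrow> 'a \<Rightarrow> nat \<Rightarrow> 'a list \<Rightarrow> ('a list \<times> 'a) list \<Rightarrow> bool" where
  "dumont_thomas_path \<eta> x p w t \<longleftrightarrow>
     p dvd length t \<and> admissible_path \<eta> x t \<and> concat (map fst (take p t)) \<noteq> [] \<and> path_word \<eta> t = w"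

lemma admissible_path_append:
  "admissible_path \<eta> x (s @ t) \<longleftrightarrow> admissible_path \<eta> x s \<and> admissible_path \<eta> (path_end x s) t"
  by (induction \<eta> x s rule: admissible_path.induct) auto

lemma admissible_iff_successively:
  "admissible \<eta> x s \<longleftrightarrow>
     s \<noteq> [] \<and> successively (\<lambda>c d. prefix (fst c @ [snd c]) (\<eta> [snd d])) s \<and>
     prefix (fst (last s) @ [snd (last s)]) (\<eta> [x])"
proof -
  have "(\<forall>i. 1 \<le> i \<and> i < length s \<longrightarrow> P (i - 1) i) \<longleftrightarrow> (\<forall>i. Suc i < length s \<longrightarrow> P i (Suc i))"
    for P
    by (metis One_nat_def Suc_le_D Suc_le_mono diff_Suc_1 le0)
  from this[of "\<lambda>i j. prefix (fst (s ! i) @ [snd (s ! i)]) (\<eta> [snd (s ! j)])"] show ?thesis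
    by (simp add: admissible_def successively_conv_nth)
qed

lemma admissible_snoc:
  "admissible \<eta> x (s @ [(m, b)]) \<longleftrightarrow>
     prefix (m @ [b]) (\<eta> [x]) \<and> (s = [] \<or> admissible \<eta> b s)"
  by (auto simp: admissible_iff_successively successively_append_iff)

lemma admissible_iff_admissible_path:
  "admissible \<eta> x s \<longleftrightarrow> s \<noteq> [] \<and> admissible_path \<eta> x (rev s)"
proof (induction s arbitrary: x rule: rev_induct)
  case Nil
  then show ?case by (simp add: admissible_def)
next
  case (snoc c s)
  then show ?case by (cases c) (auto simp: admissible_snoc)
qed

lemma path_word_rev:
  "path_word \<eta> (rev s) = concat (map (\<lambda>i. (\<eta> ^^ i) (fst (s ! i))) (rev [0..<length s]))"
proof (induction s rule: rev_induct)
  case Nil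
  then show ?case by simp
next
  case (snoc c s)
  have "map (\<lambda>i. (\<eta> ^^ i) (fst ((s @ [c]) ! i))) (rev [0..<length s]) =
      map (\<lambda>i. (\<eta> ^^ i) (fst (s ! i))) (rev [0..<length s])"
    by (auto simp: nth_append)
  with snoc show ?case by (cases c) (simp del: map_eq_conv)
qed

lemma length_dumont_thomas_path_rev_iff:
  "length s = k \<and> dumont_thomas_path \<eta> x p w (rev s) \<longleftrightarrow>
     p dvd k \<and> length s = k \<and> admissible \<eta> x s \<and>
     concat (map (\<lambda>i. fst (s ! i)) (rev [k - p..<k])) \<noteq> [] \<and>
     w = concat (map (\<lambda>i. (\<eta> ^^ i) (fst (s ! i))) (rev [0..<k]))"
proof (cases "length s = k")
  case True
  then have "concat (map (\<lambda>i. fst (s ! i)) (rev [k - p..<k])) = concat (map fst (take p (rev s)))"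
    and "concat (map (\<lambda>i. (\<eta> ^^ i) (fst (s ! i))) (rev [0..<k])) = path_word \<eta> (rev s)"
    using map_nth_rev_upt[of fst s p] by (simp_all add: path_word_rev)
  with True show ?thesis
    by (auto simp: dumont_thomas_path_def admissible_iff_admissible_path
      simp del: concat_eq_Nil_conv)
qed simp

locale nonerasing_morphism =
  fixes \<eta> :: "'a list \<Rightarrow> 'a list"
  assumes morphism: "word_morphism \<eta>"
    and nonerasing: "\<eta> [x] \<noteq> []"
begin

lemma morph_Nil [simp]: "\<eta> [] = []"
  using morphism by (simp add: word_morphism_def)

lemma morph_append: "\<eta> (v @ w) = \<eta> v @ \<eta> w"
  using morphism by (simp add: word_morphism_def)

lemma morph_eq_Nil_iff: "\<eta> w = [] \<longleftrightarrow> w = []"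
proof (cases w)
  case (Cons x v)
  then show ?thesis using morph_append[of "[x]" v] nonerasing[of x] by simp
qed simp

lemma funpow_Nil [simp]: "(\<eta> ^^ k) [] = []"
  by (induction k) simp_all

lemma funpow_append: "(\<eta> ^^ k) (v @ w) = (\<eta> ^^ k) v @ (\<eta> ^^ k) w"
  by (induction k) (simp_all add: morph_append)

lemma funpow_eq_Nil_iff [simp]: "(\<eta> ^^ k) w = [] \<longleftrightarrow> w = []"
  by (induction k) (simp_all add: morph_eq_Nil_iff)

lemma length_funpow_mono_prefix:
  "prefix v w \<Longrightarrow> length ((\<eta> ^^ k) v) \<le> length ((\<eta> ^^ k) w)"
  by (auto simp: prefix_def funpow_append)

lemma path_word_append:
  "path_word \<eta> (s @ t) = (\<eta> ^^ length t) (path_word \<eta> s) @ path_word \<eta> t"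
proof (induction s)
  case Nil
  then show ?case by simp
next
  case (Cons c s)
  then show ?case
    by (cases c) (simp add: funpow_append funpow_add add.commute[of "length s"])
qed

lemma path_word_eq_Nil_iff: "path_word \<eta> t = [] \<longleftrightarrow> concat (map fst t) = []"
  by (induction t) auto

lemma prefix_path_word_end:
  "admissible_path \<eta> x t \<Longrightarrow> prefix (path_word \<eta> t @ [path_end x t]) ((\<eta> ^^ length t) [x])"
proof (induction t arbitrary: x)
  case Nil
  then show ?case by simp
next
  case (Cons c t)
  obtain m b where c: "c = (m, b)" by (cases c)
  with Cons.prems have "prefix (m @ [b]) (\<eta> [x])" and adm: "admissible_path \<eta> b t" by auto
  then obtain r where "\<eta> [x] = m @ [b] @ r" by (auto simp: prefix_def)
  then have "(\<eta> ^^ length (c # t)) [x] =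
      (\<eta> ^^ length t) m @ (\<eta> ^^ length t) [b] @ (\<eta> ^^ length t) r"
    by (simp add: funpow_swap1 flip: funpow_append)
  with Cons.IH[OF adm] show ?case by (simp add: c)
qed

lemma length_path_word_less:
  "admissible_path \<eta> x t \<Longrightarrow> length (path_word \<eta> t) < length ((\<eta> ^^ length t) [x])"
  using prefix_path_word_end[of x t] by (auto dest: prefix_length_le)

lemma length_path_word_append_less:
  assumes "admissible_path \<eta> x (s @ t)"
  shows "length (path_word \<eta> (s @ t)) < length ((\<eta> ^^ length t) (path_word \<eta> s @ [path_end x s]))"
  using assms length_path_word_less[of "path_end x s" t]
  by (simp add: admissible_path_append path_word_append funpow_append)

lemma ex1_funpow_take_interval:
  assumes "n < length ((\<eta> ^^ k) w)"
  shows "\<exists>!i. length ((\<eta> ^^ k) (take i w)) \<le> n \<and> n < length ((\<eta> ^^ k) (take (Suc i) w))"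
proof (rule ex1_mono_interval)
  show "mono (\<lambda>i. length ((\<eta> ^^ k) (take i w)))"
  proof (rule monoI)
    fix i j :: nat
    assume "i \<le> j"
    then have "prefix (take i w) (take j w)" by (metis min.absorb1 take_is_prefix take_take)
    then show "length ((\<eta> ^^ k) (take i w)) \<le> length ((\<eta> ^^ k) (take j w))"
      by (rule length_funpow_mono_prefix)
  qed
  show "n < length ((\<eta> ^^ k) (take (length w) w))" using assms by simp
  show "length ((\<eta> ^^ k) (take 0 w)) \<le> n" by simp
qed

lemma ex1_funpow_prefix_letter:
  assumes "n < length ((\<eta> ^^ k) w)"
  shows "\<exists>!(m, b). prefix (m @ [b]) w \<and>
    length ((\<eta> ^^ k) m) \<le> n \<and> n < length ((\<eta> ^^ k) (m @ [b]))"
proof -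
  let ?start = "\<lambda>i. length ((\<eta> ^^ k) (take i w))"
  obtain i where i: "?start i \<le> n" "n < ?start (Suc i)"
    and i_unique: "\<And>j. ?start j \<le> n \<and> n < ?start (Suc j) \<Longrightarrow> j = i"
    using ex1_funpow_take_interval[OF assms] by (elim ex1E) blast
  from i have "i < length w" by (cases "i < length w") simp_all
  then have take_Suc: "take (Suc i) w = take i w @ [w ! i]" by (rule take_Suc_conv_app_nth)
  show ?thesis
  proof (rule ex1I[of _ "(take i w, w ! i)"], safe)
    show "prefix (take i w @ [w ! i]) w" by (metis take_Suc take_is_prefix)
    show "n < length ((\<eta> ^^ k) (take i w @ [w ! i]))" using i(2) by (simp add: take_Suc)
    show "length ((\<eta> ^^ k) (take i w)) \<le> n" by (rule i(1))
  next
    fix m b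
    assume "prefix (m @ [b]) w" and "length ((\<eta> ^^ k) m) \<le> n"
      "n < length ((\<eta> ^^ k) (m @ [b]))"
    moreover from this(1) have m: "m = take (length m) w"
      and mb: "m @ [b] = take (Suc (length m)) w"
      by (auto simp: prefix_def)
    ultimately have "length m = i" by (intro i_unique) simp
    with m mb take_Suc show "m = take i w" "b = w ! i" by simp_all
  qed
qed

lemma ex1_admissible_path:
  assumes "n < length ((\<eta> ^^ k) [x])"
  shows "\<exists>!t. admissible_path \<eta> x t \<and> length t = k \<and> length (path_word \<eta> t) = n"
  using assms
proof (induction k arbitrary: x n)
  case 0
  then show ?case by (auto intro!: ex1I[of _ "[]"])
next
  case (Suc k)
  have "n < length ((\<eta> ^^ k) (\<eta> [x]))" using Suc.prems by (simp add: funpow_swap1)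
  from ex1_funpow_prefix_letter[OF this] obtain m b where
    mb: "prefix (m @ [b]) (\<eta> [x])" "length ((\<eta> ^^ k) m) \<le> n" "n < length ((\<eta> ^^ k) (m @ [b]))"
    and mb_unique: "\<And>m' b'. \<lbrakk>prefix (m' @ [b']) (\<eta> [x]); length ((\<eta> ^^ k) m') \<le> n;
      n < length ((\<eta> ^^ k) (m' @ [b']))\<rbrakk> \<Longrightarrow> m' = m \<and> b' = b"
    unfolding Ex1_def split_paired_Ex split_paired_All case_prod_conv prod.inject by metis
  let ?rest = "n - length ((\<eta> ^^ k) m)"
  have "?rest < length ((\<eta> ^^ k) [b])" using mb(2,3) by (simp add: funpow_append)
  from Suc.IH[OF this] obtain t where
    t: "admissible_path \<eta> b t" "length t = k" "length (path_word \<eta> t) = ?rest"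
    and t_unique: "\<And>r. \<lbrakk>admissible_path \<eta> b r; length r = k; length (path_word \<eta> r) = ?rest\<rbrakk>
      \<Longrightarrow> r = t"
    by (elim ex1E) blast
  show ?case
  proof (rule ex1I[of _ "(m, b) # t"])
    show "admissible_path \<eta> x ((m, b) # t) \<and> length ((m, b) # t) = Suc k \<and>
        length (path_word \<eta> ((m, b) # t)) = n"
      using t mb by simp
  next
    fix s
    assume s: "admissible_path \<eta> x s \<and> length s = Suc k \<and> length (path_word \<eta> s) = n"
    then obtain m' b' r where s_eq: "s = [(m', b')] @ r" and r: "length r = k"
      by (cases s) auto
    have "m' = m \<and> b' = b"
      using s r length_path_word_append_less[of x "[(m', b')]" r]
      by (intro mb_unique) (auto simp: s_eq)
    moreover from this have "r = t" using s r by (intro t_unique) (auto simp: s_eq)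
    ultimately show "s = (m, b) # t" by (simp add: s_eq)
  qed
qed

lemma concat_map_fst_nonempty_iff:
  assumes "prefix [x] ((\<eta> ^^ length s) [x])" "admissible_path \<eta> x (s @ t)"
  shows "concat (map fst s) \<noteq> [] \<longleftrightarrow> length ((\<eta> ^^ length t) [x]) \<le> length (path_word \<eta> (s @ t))"
proof -
  have prefix_end: "prefix (path_word \<eta> s @ [path_end x s]) ((\<eta> ^^ length s) [x])"
    using assms(2) by (simp add: admissible_path_append prefix_path_word_end)
  have "path_word \<eta> s \<noteq> [] \<longleftrightarrow> length ((\<eta> ^^ length t) [x]) \<le> length (path_word \<eta> (s @ t))"
  proof (cases "path_word \<eta> s = []")
    case True
    with prefix_end assms(1) have "path_end x s = x" by (auto simp: prefix_def)
    then show ?thesis using length_path_word_append_less[OF assms(2)] True by simp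
  next
    case False
    then have "prefix [x] (path_word \<eta> s)"
      using prefix_end assms(1) by (cases "path_word \<eta> s") (auto simp: prefix_def)
    then have "length ((\<eta> ^^ length t) [x]) \<le> length ((\<eta> ^^ length t) (path_word \<eta> s))"
      by (rule length_funpow_mono_prefix)
    with False show ?thesis by (simp add: path_word_append)
  qed
  then show ?thesis by (simp only: path_word_eq_Nil_iff)
qed

lemma ex1_growing_interval:
  assumes "growing \<eta> x" "prefix [x] ((\<eta> ^^ p) [x])" "p \<ge> 1" "n \<ge> 1"
  shows "\<exists>!q. length ((\<eta> ^^ (p * q)) [x]) \<le> n \<and> n < length ((\<eta> ^^ (p * Suc q)) [x])"
proof -
  obtain N where N: "\<And>k. k \<ge> N \<Longrightarrow> Suc n \<le> length ((\<eta> ^^ k) [x])"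
    using assms(1) unfolding growing_def filterlim_at_top eventually_sequentially by metis
  show ?thesis
  proof (rule ex1_mono_interval)
    have "length ((\<eta> ^^ (p * q)) [x]) \<le> length ((\<eta> ^^ (p * q)) ((\<eta> ^^ p) [x]))" for q
      using assms(2) by (rule length_funpow_mono_prefix)
    then show "mono (\<lambda>q. length ((\<eta> ^^ (p * q)) [x]))"
      unfolding mono_iff_le_Suc by (simp add: funpow_add add.commute[of p])
    show "n < length ((\<eta> ^^ (p * N)) [x])" using N[of "p * N"] assms(3) by simp
    show "length ((\<eta> ^^ (p * 0)) [x]) \<le> n" using assms(4) by simp
  qed
qed

lemma stream_action_shift:
  "stream_action \<eta> (w @- u) = \<eta> w @- stream_action \<eta> u"
proof (induction w)
  case Nil
  then show ?case by simp
next
  case (Cons x w)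
  have "stream_action \<eta> ((x # w) @- u) = \<eta> [x] @- stream_action \<eta> (w @- u)"
    by (simp add: stream_action_def flat_Stream nonerasing)
  with Cons show ?case using morph_append[of "[x]" w] by simp
qed

lemma funpow_stream_action_shift:
  "(stream_action \<eta> ^^ k) (w @- u) = (\<eta> ^^ k) w @- (stream_action \<eta> ^^ k) u"
  by (induction k) (simp_all add: stream_action_shift)

lemma stake_funpow_stream_action:
  assumes "prefix w ((\<eta> ^^ k) [shd u])"
  shows "stake (length w) ((stream_action \<eta> ^^ k) u) = w"
proof -
  have "(stream_action \<eta> ^^ k) u = (\<eta> ^^ k) [shd u] @- (stream_action \<eta> ^^ k) (stl u)"
    using funpow_stream_action_shift[of k "[shd u]" "stl u"] by simp
  then show ?thesis using assms by (auto simp: prefix_def stake_shift)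
qed

lemma prefix_shd_periodic:
  assumes "(stream_action \<eta> ^^ p) u = u"
  shows "prefix [shd u] ((\<eta> ^^ p) [shd u])"
proof (cases "(\<eta> ^^ p) [shd u]")
  case Nil
  then show ?thesis by simp
next
  case (Cons y w)
  then show ?thesis using stake_funpow_stream_action[of "[y]" p u] assms by simp
qed

lemma path_word_eq_stake_iff:
  assumes "(stream_action \<eta> ^^ p) u = u" "p dvd length t" "admissible_path \<eta> (shd u) t"
  shows "path_word \<eta> t = stake n u \<longleftrightarrow> length (path_word \<eta> t) = n"
proof -
  have "(stream_action \<eta> ^^ length t) u = u"
    using funpow_mod_eq[OF assms(1), of "length t"] assms(2) by simp
  moreover have "prefix (path_word \<eta> t) ((\<eta> ^^ length t) [shd u])"
    using prefix_path_word_end[OF assms(3)] by (rule append_prefixD)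
  ultimately have "stake (length (path_word \<eta> t)) u = path_word \<eta> t"
    by (metis stake_funpow_stream_action)
  then show ?thesis by (metis length_stake)
qed

lemma dumont_thomas_path_stake_iff:
  assumes "is_period \<eta> u p"
  shows "dumont_thomas_path \<eta> (shd u) p (stake n u) t \<longleftrightarrow>
    (\<exists>q. length t = p * Suc q \<and> length ((\<eta> ^^ (p * q)) [shd u]) \<le> n) \<and>
    admissible_path \<eta> (shd u) t \<and> length (path_word \<eta> t) = n"
    (is "_ \<longleftrightarrow> (\<exists>q. ?block q) \<and> _")
proof (cases "\<exists>q. length t = p * Suc q \<and> admissible_path \<eta> (shd u) t")
  case True
  then obtain q where len: "length t = p * Suc q" and adm: "admissible_path \<eta> (shd u) t" by blast
  have p: "p \<ge> 1" and per: "(stream_action \<eta> ^^ p) u = u"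
    using assms by (auto simp: is_period_def)
  have "concat (map fst (take p t)) \<noteq> [] \<longleftrightarrow>
      length ((\<eta> ^^ (p * q)) [shd u]) \<le> length (path_word \<eta> t)"
    using concat_map_fst_nonempty_iff[of "shd u" "take p t" "drop p t"] prefix_shd_periodic[OF per]
      adm len by simp
  moreover have "path_word \<eta> t = stake n u \<longleftrightarrow> length (path_word \<eta> t) = n"
    using len adm by (intro path_word_eq_stake_iff[OF per]) simp_all
  moreover have "(\<exists>r. ?block r) \<longleftrightarrow> length ((\<eta> ^^ (p * q)) [shd u]) \<le> n"
    using len p by auto
  ultimately show ?thesis using len adm by (auto simp: dumont_thomas_path_def)
next
  case False
  moreover have "\<exists>q. length t = p * Suc q" if "dumont_thomas_path \<eta> (shd u) p (stake n u) t"
  proof -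
    from that have "p dvd length t" "t \<noteq> []" by (auto simp: dumont_thomas_path_def)
    then show ?thesis by (metis dvd_def length_0_conv mult_0_right not0_implies_Suc)
  qed
  ultimately show ?thesis by (auto simp: dumont_thomas_path_def)
qed

lemma ex1_dumont_thomas_path:
  assumes "growing \<eta> (shd u)" "is_period \<eta> u p" "n \<ge> 1"
  shows "\<exists>!t. dumont_thomas_path \<eta> (shd u) p (stake n u) t"
proof -
  let ?L = "\<lambda>q. length ((\<eta> ^^ (p * q)) [shd u])"
  have "p \<ge> 1" "prefix [shd u] ((\<eta> ^^ p) [shd u])"
    using assms(2) prefix_shd_periodic by (auto simp: is_period_def)
  then have "\<exists>!q. ?L q \<le> n \<and> n < ?L (Suc q)" using assms by (intro ex1_growing_interval)
  then obtain q where q: "?L q \<le> n" "n < ?L (Suc q)"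
    and q_unique: "\<And>r. ?L r \<le> n \<and> n < ?L (Suc r) \<Longrightarrow> r = q"
    by (elim ex1E) blast
  have "dumont_thomas_path \<eta> (shd u) p (stake n u) t \<longleftrightarrow>
      admissible_path \<eta> (shd u) t \<and> length t = p * Suc q \<and> length (path_word \<eta> t) = n" for t
    unfolding dumont_thomas_path_stake_iff[OF assms(2)]
    using q q_unique length_path_word_less[of "shd u" t] by metis
  then show ?thesis using ex1_admissible_path[OF q(2)] by simp
qed

end

theorem theorem11:
  fixes \<eta> :: "('a::finite) list \<Rightarrow> 'a list"
    and a :: 'a and u :: "'a stream" and p n :: nat
  assumes "substitution \<eta>"
    and "growing \<eta> a"
    and "periodic_point \<eta> u"
    and "u !! 0 = a"
    and "is_period \<eta> u p"
    and "n \<ge> 1"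
  shows "\<exists>!(k, s). p dvd k \<and> length s = k \<and>
           admissible \<eta> a s \<and>
           concat (map (\<lambda>i. fst (s ! i)) (rev [k - p..<k])) \<noteq> [] \<and>
           stake n u = concat (map (\<lambda>i. (\<eta> ^^ i) (fst (s ! i))) (rev [0..<k]))"
proof -
  interpret nonerasing_morphism \<eta>
    using assms(1) by unfold_locales (auto simp: substitution_def)
  have "\<exists>!t. dumont_thomas_path \<eta> a p (stake n u) t"
    using ex1_dumont_thomas_path[of u p n] assms by simp
  then obtain t where t: "dumont_thomas_path \<eta> a p (stake n u) t"
    and t_unique: "\<And>s. dumont_thomas_path \<eta> a p (stake n u) s \<Longrightarrow> s = t"
    by (elim ex1E) blast
  have "\<exists>!(k, s). length s = k \<and> dumont_thomas_path \<eta> a p (stake n u) (rev s)"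
    using t by (intro ex1I[of _ "(length t, rev t)"]) (auto dest!: t_unique)
  then show ?thesis unfolding length_dumont_thomas_path_rev_iff .
qed

end
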